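(* Let $\delta>0$, let $n,D,d$ be integers with $1\le d\le D<n$, and let $\mathbf{x}\in\{0,1\}^n$ be any input vector with exactly $d$ ones. Put $\Gamma=\frac{\ln D}{\ln n}$, $w'=1+\frac1D$ and $$\beta=(\delta+1+\Gamma)\,\ln(2)\,2e^2\,w'\left(w'+1/3\right).$$ If $T$ is an integer with $T\ge\beta\,D\log_2 n$, then the LiPo algorithm with $T$ tests satisfies $$\Pr[\hat{\mathbf{x}}\neq\mathbf{x}]\le n^{-\delta},$$ where the probability is over the random choice of the group-testing matrix.
   Context: Group testing: there are $n$ items, of which an unknown subset of $d$ items is defective, encoded by $\mathbf{x}\in\{0,1\}^n$ ($x_j=1$ iff item $j$ is defective); $D\ge d$ is a known upper bound. A $T\times n$ binary group-testing matrix $M=(m_{i,j})$ specifies non-adaptive tests: item $j$ is in test $i$ iff $m_{i,j}=1$. Measurements are noiseless: the outcome $y_i\in\{0,1\}$ of test $i$ is $1$ iff test $i$ contains at least one defective item. LiPo (linear programming decoding) algorithm. Encoding: the entries $m_{i,j}$ are i.i.d., equal to $1$ with probability $p$ and $0$ otherwise, where $p=1/D$ if $D\ge 2$, and $p=1/2$ if $D=1$. Decoding ($d$ is assumed known to the decoder): output an arbitrary feasible point $\hat{\mathbf{x}}=(x_1,\dots,x_n)\in\mathbb{R}^n$ of the constraints $$\sum_{j:\,m_{i,j}=1}x_j=0\ \text{ for every } i\text{ with } y_i=0,\qquad \sum_{j=1}^n x_j=d,\qquad 0\le x_j\le 1\ (1\le j\le n).$$ *)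

theory Defs
  imports "HOL-Probability.Probability" "HOL-Probability.Product_PMF"
begin

text \<open>
  Items are indexed by \<open>{..<n}\<close> and tests by \<open>{..<T}\<close>. A test matrix is a Boolean
  function on pairs, \<open>M (i, j)\<close> standing for \<open>m_ij = 1\<close>; vectors indexed by the items are
  functions \<open>nat \<Rightarrow> real\<close> of which only the values below \<open>n\<close> matter.
\<close>

definition lipo_prob :: "nat \<Rightarrow> real" where
  "lipo_prob D = (if D = 1 then 1 / 2 else 1 / real D)"

text \<open>Entries outside \<open>{..<T} \<times> {..<n}\<close> are constantly \<open>False\<close>.\<close>

definition lipo_matrix :: "nat \<Rightarrow> nat \<Rightarrow> nat \<Rightarrow> (nat \<times> nat \<Rightarrow> bool) pmf" where
  "lipo_matrix T n D =
     Pi_pmf ({..<T} \<times> {..<n}) False (\<lambda>_. bernoulli_pmf (lipo_prob D))"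

definition test_outcome :: "nat \<Rightarrow> (nat \<times> nat \<Rightarrow> bool) \<Rightarrow> (nat \<Rightarrow> real) \<Rightarrow> nat \<Rightarrow> bool" where
  "test_outcome n M x i \<longleftrightarrow> (\<exists>j<n. M (i, j) \<and> x j = 1)"

definition lipo_feasible ::
  "nat \<Rightarrow> nat \<Rightarrow> nat \<Rightarrow> (nat \<times> nat \<Rightarrow> bool) \<Rightarrow> (nat \<Rightarrow> bool) \<Rightarrow> (nat \<Rightarrow> real) \<Rightarrow> bool" where
  "lipo_feasible T n d M y z \<longleftrightarrow>
     (\<forall>i<T. \<not> y i \<longrightarrow> (\<Sum>j | j < n \<and> M (i, j). z j) = 0) \<and>
     (\<Sum>j<n. z j) = real d \<and>
     (\<forall>j<n. 0 \<le> z j \<and> z j \<le> 1)"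

text \<open>
  A decoder sees the matrix and the outcomes and may return any feasible point. Nothing is
  required on pairs \<open>M\<close>, \<open>y\<close> without feasible points; such pairs do not arise from
  an input with \<open>d\<close> defectives, because that input is itself feasible.
\<close>

definition lipo_decoder ::
  "nat \<Rightarrow> nat \<Rightarrow> nat \<Rightarrow> ((nat \<times> nat \<Rightarrow> bool) \<Rightarrow> (nat \<Rightarrow> bool) \<Rightarrow> nat \<Rightarrow> real) \<Rightarrow> bool" where
  "lipo_decoder T n d dec \<longleftrightarrow>
     (\<forall>M y. (\<exists>z. lipo_feasible T n d M y z) \<longrightarrow> lipo_feasible T n d M y (dec M y))"

lemma lipo_feasible_input:
  assumes "\<forall>j<n. x j \<in> {0, 1}" and "card {j. j < n \<and> x j = 1} = d"
  shows "lipo_feasible T n d M (test_outcome n M x) x"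
proof -
  have "(\<Sum>j<n. x j) = (\<Sum>j<n. if x j = 1 then 1 else 0)"
    using assms(1) by (intro sum.cong) auto
  also have "\<dots> = real (card {j. j < n \<and> x j = 1})"
    by (simp add: sum.If_cases Collect_conj_eq lessThan_def)
  finally have "(\<Sum>j<n. x j) = real d"
    using assms(2) by simp
  then show ?thesis
    using assms(1) unfolding lipo_feasible_def test_outcome_def
    by (auto intro!: sum.neutral)
qed

end

theory Submission imports Defs begin

text \<open>
  Call an item non-defective if it is not a one of \<open>x\<close>. If every non-defective item lies in some
  test without defective items, then the constraints force every feasible point to vanish there;
  the remaining \<open>d\<close> coordinates are at most \<open>1\<close> and add up to \<open>d\<close>, so they all equal \<open>1\<close>.
  A given test does this for a given non-defective item with probability
  \<open>p (1 - p)\<^sup>d \<ge> 1 / (2 e\<^sup>2 D)\<close>, independently over the tests, so a union bound over the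
  items gives failure probability at most \<open>n exp (- T / (2 e\<^sup>2 D)) \<le> n\<^bsup>- \<delta>\<^esup>\<close>.
\<close>

section \<open>Independence of events on disjoint blocks of coordinates\<close>

lemma measure_pmf_prob_pair_times:
  "measure_pmf.prob (pair_pmf P Q) (A \<times> B) = measure_pmf.prob P A * measure_pmf.prob Q B"
proof -
  \<comment> \<open>\<open>measure_pmf_prob_product\<close> asks for countable sets; cutting down to
    the supports, which are countable, changes no probability.\<close>
  have "measure_pmf.prob (pair_pmf P Q) (A \<times> B)
      = measure_pmf.prob (pair_pmf P Q) ((A \<inter> set_pmf P) \<times> (B \<inter> set_pmf Q))"
    by (subst measure_Int_set_pmf[symmetric]) (simp add: Times_Int_Times)
  also have "\<dots> = measure_pmf.prob P (A \<inter> set_pmf P) * measure_pmf.prob Q (B \<inter> set_pmf Q)"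
    by (intro measure_pmf_prob_product) auto
  finally show ?thesis
    by (simp add: measure_Int_set_pmf)
qed

text \<open>The last assumption makes \<open>E i\<close> depend only on the coordinates in
  \<open>B i\<close>. Induction on \<open>I\<close> splits off one block at a time with
  \<open>Pi_pmf_union\<close>.\<close>

lemma measure_Pi_pmf_blocks:
  assumes "finite I" and "\<And>i. i \<in> I \<Longrightarrow> finite (B i)" and "disjoint_family_on B I"
    and "\<And>i f g. i \<in> I \<Longrightarrow> (\<And>k. k \<in> B i \<Longrightarrow> f k = g k) \<Longrightarrow> f \<in> E i \<longleftrightarrow> g \<in> E i"
  shows "measure_pmf.prob (Pi_pmf (\<Union>i\<in>I. B i) dflt p) (\<Inter>i\<in>I. E i)
       = (\<Prod>i\<in>I. measure_pmf.prob (Pi_pmf (B i) dflt p) (E i))"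
  using assms
proof (induction I rule: finite_induct)
  case empty
  then show ?case by simp
next
  case (insert i I)
  let ?U = "\<Union>j\<in>I. B j"
  let ?glue = "\<lambda>(f, g) k. if k \<in> B i then f k else g k"
  have disj: "B i \<inter> ?U = {}"
    using insert.prems(2) insert.hyps(2) by (fastforce simp: disjoint_family_on_def)
  have fin: "finite (B i)" "finite ?U"
    using insert.prems(1) insert.hyps(1) by auto
  have glue_i: "(\<lambda>k. if k \<in> B i then f k else g k) \<in> E i \<longleftrightarrow> f \<in> E i" for f g
    by (rule insert.prems(3)) auto
  have glue_I: "(\<lambda>k. if k \<in> B i then f k else g k) \<in> E j \<longleftrightarrow> g \<in> E j" if "j \<in> I" for f g j
    using that disj by (intro insert.prems(3)) auto
  \<comment> \<open>A glued function agrees with \<open>f\<close> on \<open>B i\<close> and with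
    \<open>g\<close> on the other blocks, so the intersection pulls back to a rectangle.\<close>
  have pre: "?glue -` (\<Inter>j\<in>insert i I. E j) = E i \<times> (\<Inter>j\<in>I. E j)"
    by (auto simp: glue_i glue_I)
  have "measure_pmf.prob (Pi_pmf (\<Union>j\<in>insert i I. B j) dflt p) (\<Inter>j\<in>insert i I. E j)
      = measure_pmf.prob (pair_pmf (Pi_pmf (B i) dflt p) (Pi_pmf ?U dflt p))
          (E i \<times> (\<Inter>j\<in>I. E j))"
    using fin disj by (simp only: UN_insert Pi_pmf_union measure_map_pmf pre)
  also have "\<dots> = measure_pmf.prob (Pi_pmf (B i) dflt p) (E i)
                * measure_pmf.prob (Pi_pmf ?U dflt p) (\<Inter>j\<in>I. E j)"
    by (rule measure_pmf_prob_pair_times)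
  also have "measure_pmf.prob (Pi_pmf ?U dflt p) (\<Inter>j\<in>I. E j)
      = (\<Prod>j\<in>I. measure_pmf.prob (Pi_pmf (B j) dflt p) (E j))"
  proof (rule insert.IH)
    show "finite (B j)" if "j \<in> I" for j
      using insert.prems(1) that by simp
    show "disjoint_family_on B I"
      using insert.prems(2) by (auto simp: disjoint_family_on_def)
    show "f \<in> E j \<longleftrightarrow> g \<in> E j" if "j \<in> I" "\<And>k. k \<in> B j \<Longrightarrow> f k = g k" for j f g
      using that by (intro insert.prems(3)) auto
  qed
  finally show ?case
    using insert.hyps by simp
qed

section \<open>Probability that an item is isolated by a test\<close>

text \<open>With \<open>S\<close> the set of defective items, such a test is negative and so
  certifies that item \<open>j\<close> is not defective.\<close>

definition isolates :: "(nat \<times> nat \<Rightarrow> bool) \<Rightarrow> nat \<Rightarrow> nat \<Rightarrow> nat set \<Rightarrow> bool" where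
  "isolates M i j S \<longleftrightarrow> M (i, j) \<and> (\<forall>k\<in>S. \<not> M (i, k))"

lemma prob_row_isolates:
  assumes p: "0 \<le> p" "p \<le> 1" and "j < n" and "j \<notin> S" and "S \<subseteq> {..<n}"
  shows "measure_pmf.prob (Pi_pmf ({i} \<times> {..<n}) False (\<lambda>_. bernoulli_pmf p)) {M. isolates M i j S}
       = p * (1 - p) ^ card S"
proof -
  \<comment> \<open>The event is a box with sides \<open>V k\<close>, so its probability factors
    over the entries of the row.\<close>
  define V where "V k = (if k = j then {True} else if k \<in> S then {False} else UNIV)" for k
  \<comment> \<open>As \<open>j\<close> lies outside \<open>S\<close>, at most one of the two
    constraints acts on each \<open>k\<close>; the product form separates them.\<close>
  have V: "measure_pmf.prob (bernoulli_pmf p) (V k)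
      = (if k = j then p else 1) * (if k \<in> S then 1 - p else 1)" for k
    using p assms(4) by (auto simp: V_def measure_pmf_single)
  have "{M. isolates M i j S} = Pi ({i} \<times> {..<n}) (\<lambda>(_, k). V k)"
  proof (rule set_eqI)
    fix M
    have "M \<in> Pi ({i} \<times> {..<n}) (\<lambda>(_, k). V k) \<longleftrightarrow> (\<forall>k<n. M (i, k) \<in> V k)"
      by (auto simp: Pi_def)
    also have "\<dots> \<longleftrightarrow> isolates M i j S"
      using assms(3-5) by (auto simp: isolates_def V_def)
    finally show "M \<in> {M. isolates M i j S} \<longleftrightarrow> M \<in> Pi ({i} \<times> {..<n}) (\<lambda>(_, k). V k)"
      by simp
  qed
  then have "measure_pmf.prob (Pi_pmf ({i} \<times> {..<n}) False (\<lambda>_. bernoulli_pmf p))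
        {M. isolates M i j S}
      = (\<Prod>(i', k)\<in>{i} \<times> {..<n}. measure_pmf.prob (bernoulli_pmf p) (V k))"
    by (simp add: measure_Pi_pmf_Pi case_prod_unfold)
  also have "\<dots> = (\<Prod>k<n. measure_pmf.prob (bernoulli_pmf p) (V k))"
    by (simp add: prod.cartesian_product[symmetric])
  also have "\<dots> = (\<Prod>k<n. if k = j then p else 1) * (\<Prod>k<n. if k \<in> S then 1 - p else 1)"
    by (simp add: V prod.distrib)
  also have "(\<Prod>k<n. if k = j then p else 1) = p"
    using assms(3) by simp
  also have "(\<Prod>k<n. if k \<in> S then 1 - p else 1) = (1 - p) ^ card S"
    using assms(5) by (simp add: prod.If_cases Int_absorb1)
  finally show ?thesis .
qed

text \<open>The rows of the matrix are disjoint blocks, so the \<open>T\<close> tests fail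
  independently.\<close>

lemma prob_no_test_isolates:
  assumes p: "0 \<le> p" "p \<le> 1" and "j < n" and "j \<notin> S" and "S \<subseteq> {..<n}"
  shows "measure_pmf.prob (Pi_pmf ({..<T} \<times> {..<n}) False (\<lambda>_. bernoulli_pmf p))
           {M. \<forall>i<T. \<not> isolates M i j S} = (1 - p * (1 - p) ^ card S) ^ T"
proof -
  have row: "measure_pmf.prob (Pi_pmf ({i} \<times> {..<n}) False (\<lambda>_. bernoulli_pmf p))
      {M. \<not> isolates M i j S} = 1 - p * (1 - p) ^ card S" for i
    using measure_pmf.prob_compl[of "{M. isolates M i j S}"
        "Pi_pmf ({i} \<times> {..<n}) False (\<lambda>_. bernoulli_pmf p)"]
      prob_row_isolates[OF assms]
    by (simp add: Compl_eq_Diff_UNIV[symmetric] Collect_neg_eq[symmetric])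
  have "{M. \<forall>i<T. \<not> isolates M i j S} = (\<Inter>i\<in>{..<T}. {M. \<not> isolates M i j S})"
    by auto
  moreover have "{..<T} \<times> {..<n} = (\<Union>i\<in>{..<T}. {i} \<times> {..<n})"
    by auto
  moreover have "measure_pmf.prob
        (Pi_pmf (\<Union>i\<in>{..<T}. {i} \<times> {..<n}) False (\<lambda>_. bernoulli_pmf p))
        (\<Inter>i\<in>{..<T}. {M. \<not> isolates M i j S})
      = (\<Prod>i<T. measure_pmf.prob (Pi_pmf ({i} \<times> {..<n}) False (\<lambda>_. bernoulli_pmf p))
          {M. \<not> isolates M i j S})"
  proof (rule measure_Pi_pmf_blocks)
    fix i and f g :: "nat \<times> nat \<Rightarrow> bool"
    assume eq: "\<And>k. k \<in> {i} \<times> {..<n} \<Longrightarrow> f k = g k"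
    have "f (i, k) = g (i, k)" if "k \<in> insert j S" for k
      using that assms(3,5) by (intro eq) auto
    then show "f \<in> {M. \<not> isolates M i j S} \<longleftrightarrow> g \<in> {M. \<not> isolates M i j S}"
      by (simp add: isolates_def)
  qed (auto simp: disjoint_family_on_def)
  ultimately show ?thesis
    by (simp add: row)
qed

section \<open>Uniqueness of the feasible point\<close>

lemma lipo_feasible_unique:
  assumes x: "\<forall>j<n. x j \<in> {0, 1}" and d: "card {j. j < n \<and> x j = 1} = d"
    and z: "lipo_feasible T n d M (test_outcome n M x) z"
    and isolated: "\<And>j. j < n \<Longrightarrow> x j = 0 \<Longrightarrow> \<exists>i<T. isolates M i j {j. j < n \<and> x j = 1}"
    and "j < n"
  shows "z j = x j"
proof -
  let ?S = "{j. j < n \<and> x j = 1}"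
  have z01: "0 \<le> z k" "z k \<le> 1" if "k < n" for k
    using z that by (auto simp: lipo_feasible_def)
  have zero: "z k = 0" if k: "k < n" "x k = 0" for k
  proof -
    obtain i where i: "i < T" "isolates M i k ?S"
      using isolated[OF k] by blast
    then have "\<not> test_outcome n M x i"
      by (auto simp: test_outcome_def isolates_def)
    then have "(\<Sum>l | l < n \<and> M (i, l). z l) = 0"
      using z i(1) by (simp add: lipo_feasible_def)
    \<comment> \<open>Feasible coordinates are nonnegative, so a vanishing sum over a negative test
      makes each of its terms vanish.\<close>
    then have "\<forall>l\<in>{l. l < n \<and> M (i, l)}. z l = 0"
      by (subst (asm) sum_nonneg_eq_0_iff) (auto intro: z01)
    then show ?thesis
      using i k by (simp add: isolates_def)
  qed
  have "real d = (\<Sum>k<n. z k)"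
    using z by (simp add: lipo_feasible_def)
  also have "\<dots> = (\<Sum>k\<in>?S. z k)"
    using zero x by (intro sum.mono_neutral_right) auto
  \<comment> \<open>Since \<open>?S\<close> has \<open>d\<close> elements, the nonnegative slacks
    \<open>1 - z k\<close> have total zero.\<close>
  finally have "(\<Sum>k\<in>?S. 1 - z k) = 0"
    using d by (simp add: sum_subtractf)
  then have "\<forall>k\<in>?S. 1 - z k = 0"
    by (subst (asm) sum_nonneg_eq_0_iff) (auto intro: z01)
  then show ?thesis
    using zero[of j] x \<open>j < n\<close> by auto
qed

section \<open>Numerical bounds on the test density\<close>

lemma one_minus_ge_exp:
  fixes x :: real
  assumes "0 \<le> x" "x \<le> 1 / 2"
  shows "exp (- 2 * x) \<le> 1 - x"
proof -
  \<comment> \<open>This turns the library bound \<open>- x - 2 * x\<^sup>2\<close> for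
    \<open>ln (1 - x)\<close> into the linear bound \<open>- 2 * x\<close>.\<close>
  have "2 * x\<^sup>2 \<le> x"
    using mult_right_mono[OF assms(2,1)] by (simp add: power2_eq_square)
  then have "- 2 * x \<le> ln (1 - x)"
    using ln_one_minus_pos_lower_bound[OF assms] by linarith
  then show ?thesis
    using assms by (simp add: ln_ge_iff)
qed

text \<open>The upper bound \<open>1 / 2\<close> is what \<open>one_minus_ge_exp\<close> asks for.
  The factor 2 in the last bound comes from \<open>D = 1\<close>, where equality holds.\<close>

lemma lipo_prob_bounds:
  assumes "1 \<le> D"
  shows "0 \<le> lipo_prob D" "lipo_prob D \<le> 1 / 2" "lipo_prob D * real D \<le> 1"
    "1 / (2 * real D) \<le> lipo_prob D"
  using assms by (auto simp: lipo_prob_def field_simps)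

text \<open>With \<open>p = lipo_prob D\<close>, the power is at least
  \<open>exp (- 2 * p * d)\<close>, and \<open>p * d \<le> p * D \<le> 1\<close>.\<close>

lemma lipo_isolation_prob_ge:
  assumes "1 \<le> D" "d \<le> D"
  shows "exp (- 2) / (2 * real D) \<le> lipo_prob D * (1 - lipo_prob D) ^ d"
proof -
  let ?p = "lipo_prob D"
  note p = lipo_prob_bounds[OF assms(1)]
  have "?p * real d \<le> ?p * real D"
    using assms(2) p(1) by (intro mult_left_mono) auto
  then have "exp (- 2) \<le> exp (real d * (- 2 * ?p))"
    using p(3) by (simp add: mult.commute)
  also have "\<dots> = exp (- 2 * ?p) ^ d"
    by (rule exp_of_nat_mult)
  also have "\<dots> \<le> (1 - ?p) ^ d"
    using one_minus_ge_exp[OF p(1,2)] by (intro power_mono) auto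
  finally have "1 / (2 * real D) * exp (- 2) \<le> ?p * (1 - ?p) ^ d"
    using p(1,4) by (intro mult_mono) auto
  then show ?thesis
    by simp
qed

theorem theorem9:
  fixes \<delta> \<Gamma> w' \<beta> :: real
    and n D d T :: nat
    and x :: "nat \<Rightarrow> real"
    and dec :: "(nat \<times> nat \<Rightarrow> bool) \<Rightarrow> (nat \<Rightarrow> bool) \<Rightarrow> nat \<Rightarrow> real"
  assumes "\<delta> > 0"
    and "1 \<le> d" and "d \<le> D" and "D < n"
    and "\<forall>j<n. x j \<in> {0, 1}" and "card {j. j < n \<and> x j = 1} = d"
    and "\<Gamma> = ln (real D) / ln (real n)"
    and "w' = 1 + 1 / real D"
    and "\<beta> = (\<delta> + 1 + \<Gamma>) * ln 2 * 2 * (exp 1)\<^sup>2 * w' * (w' + 1 / 3)"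
    and "real T \<ge> \<beta> * real D * log 2 (real n)"
    and "lipo_decoder T n d dec"
  shows "measure_pmf.prob (lipo_matrix T n D)
           {M. \<exists>j<n. dec M (test_outcome n M x) j \<noteq> x j} \<le> real n powr (- \<delta>)"
proof -
  define S where "S = {j. j < n \<and> x j = 1}"
  define q where "q = lipo_prob D * (1 - lipo_prob D) ^ d"
  have D: "1 \<le> D" and n: "1 < n"
    using assms by auto
  have ln_n: "0 < ln (real n)"
    using n by simp
  have S: "S \<subseteq> {..<n}" "card S = d"
    using assms(6) by (auto simp: S_def)
  have p: "0 \<le> lipo_prob D" "lipo_prob D \<le> 1"
    using lipo_prob_bounds[OF D] by auto
  define Bad where "Bad j = {M. \<forall>i<T. \<not> isolates M i j S}" for j
  have "q \<le> 1"
    using p mult_le_one[of "lipo_prob D" "(1 - lipo_prob D) ^ d"]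
    by (simp add: q_def power_le_one)
  have q: "exp (- 2) / (2 * real D) \<le> q"
    unfolding q_def by (rule lipo_isolation_prob_ge[OF D assms(3)])

  \<comment> \<open>Here \<open>\<Gamma> \<ge> 0\<close> and \<open>w' \<ge> 1\<close>, so these
    factors of \<open>\<beta>\<close> can only enlarge the right-hand side.\<close>
  have "(\<delta> + 1) * ln (real n) \<le> (\<delta> + 1 + \<Gamma>) * (w' * (w' + 1 / 3)) * ln (real n)"
  proof -
    have "0 \<le> \<Gamma>"
      using D ln_n assms(7) by simp
    moreover have "1 \<le> w'"
      using assms(8) by simp
    then have "1 * 1 \<le> w' * (w' + 1 / 3)"
      by (intro mult_mono) auto
    ultimately have "(\<delta> + 1) * 1 \<le> (\<delta> + 1 + \<Gamma>) * (w' * (w' + 1 / 3))"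
      using assms(1) by (intro mult_mono) auto
    then show ?thesis
      using ln_n by (intro mult_right_mono) auto
  qed
  \<comment> \<open>The \<open>ln 2\<close> in \<open>\<beta>\<close> converts \<open>log 2\<close>
    to \<open>ln\<close>, and its \<open>2 * (exp 1)\<^sup>2\<close> together with \<open>D\<close>
    cancels the lower bound on \<open>q\<close>.\<close>
  also have "\<dots> = \<beta> * real D * log 2 (real n) * (exp (- 2) / (2 * real D))"
  proof -
    have "exp 1 * exp 1 * exp (- 2) = (1 :: real)"
      by (simp flip: exp_add)
    then show ?thesis
      using D unfolding assms(9) by (simp add: log_def power2_eq_square mult_ac)
  qed
  also have "\<dots> \<le> real T * (exp (- 2) / (2 * real D))"
    using assms(10) by (intro mult_right_mono) auto
  also have "\<dots> \<le> real T * q"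
    using q by (intro mult_left_mono) auto
  finally have exponent: "(\<delta> + 1) * ln (real n) \<le> real T * q" .

  \<comment> \<open>\<open>q \<le> 1\<close> keeps the base \<open>1 - q\<close> nonnegative, as
    monotonicity of the power requires.\<close>
  have "(1 - q) ^ T \<le> exp (- q) ^ T"
    using \<open>q \<le> 1\<close> exp_ge_add_one_self[of "- q"] by (intro power_mono) auto
  also have "\<dots> = exp (- (real T * q))"
    by (simp flip: exp_of_nat_mult)
  also have "\<dots> \<le> exp (- ((\<delta> + 1) * ln (real n)))"
    using exponent by simp
  \<comment> \<open>The extra \<open>- 1\<close> in the exponent pays for the union bound over at
    most \<open>n\<close> items.\<close>
  also have "\<dots> = real n powr (- \<delta> - 1)"
    using n by (simp add: powr_def algebra_simps)
  finally have tail: "(1 - q) ^ T \<le> real n powr (- \<delta> - 1)" .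

  have bad: "measure_pmf.prob (lipo_matrix T n D) (Bad j) \<le> real n powr (- \<delta> - 1)"
    if "j < n" "j \<notin> S" for j
    using prob_no_test_isolates[OF p that S(1), of T] tail
    by (simp add: lipo_matrix_def Bad_def q_def S(2))

  have "{M. \<exists>j<n. dec M (test_outcome n M x) j \<noteq> x j} \<subseteq> (\<Union>j\<in>{..<n} - S. Bad j)"
  proof (rule subsetI, rule ccontr)
    fix M
    assume M: "M \<in> {M. \<exists>j<n. dec M (test_outcome n M x) j \<noteq> x j}"
      and "M \<notin> (\<Union>j\<in>{..<n} - S. Bad j)"
    then have "\<exists>i<T. isolates M i j S" if "j < n" "x j = 0" for j
      using that by (auto simp: Bad_def S_def)
    \<comment> \<open>The input is itself feasible, so the decoder is bound to return a feasible
      point.\<close>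
    moreover have "lipo_feasible T n d M (test_outcome n M x) (dec M (test_outcome n M x))"
      using assms(11) lipo_feasible_input[OF assms(5,6)] unfolding lipo_decoder_def by blast
    ultimately have "dec M (test_outcome n M x) j = x j" if "j < n" for j
      using lipo_feasible_unique[OF assms(5,6) _ _ that] unfolding S_def by blast
    with M show False
      by auto
  qed
  then have "measure_pmf.prob (lipo_matrix T n D) {M. \<exists>j<n. dec M (test_outcome n M x) j \<noteq> x j}
      \<le> measure_pmf.prob (lipo_matrix T n D) (\<Union>j\<in>{..<n} - S. Bad j)"
    by (intro measure_pmf.finite_measure_mono) auto
  also have "\<dots> \<le> (\<Sum>j\<in>{..<n} - S. measure_pmf.prob (lipo_matrix T n D) (Bad j))"
    by (intro measure_pmf.finite_measure_subadditive_finite) auto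
  also have "\<dots> \<le> (\<Sum>j\<in>{..<n} - S. real n powr (- \<delta> - 1))"
    using bad by (intro sum_mono) auto
  also have "\<dots> \<le> (\<Sum>j<n. real n powr (- \<delta> - 1))"
    by (intro sum_mono2) auto
  also have "\<dots> = real n powr (- \<delta>)"
    using n powr_mult_base[of "real n" "- \<delta> - 1"] by simp
  finally show ?thesis .
qed

end
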